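(* For any integer $L\ge 2$ and any positive odd integers $p,q$, the number of Kempe equivalence classes of four-colorings of the triangulation $T(3Lp,3Lq)$ of the torus satisfies $\kappa(T(3Lp,3Lq),4)\ge 2$.
   Context: The triangulation $T(r,s)$ of the torus has vertex set $\mathbb{Z}/r\mathbb{Z}\times\mathbb{Z}/s\mathbb{Z}$; edges join $(x,y)$ to $(x+1,y)$, $(x,y+1)$ and $(x+1,y+1)$; triangles are $\{(x,y),(x+1,y),(x+1,y+1)\}$ and $\{(x,y),(x,y+1),(x+1,y+1)\}$. A four-coloring is a proper vertex coloring with colors $\{1,2,3,4\}$. A Kempe change (K-change) interchanges two colors $a,b$ on one connected component of the subgraph induced by the vertices colored $a$ or $b$. Two colorings are Kempe equivalent if one can be obtained from the other by a finite sequence of K-changes. $\kappa(G,4)$ is the number of Kempe equivalence classes of four-colorings of $G$ (colorings differing by a global permutation of colors are identified). *)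

theory Defs
  imports "HOL-Library.FuncSet" "HOL-Combinatorics.Permutations"
begin

record 'v ugraph =
  verts :: "'v set"
  edges :: "'v set set"

record 'v triangulation = "'v ugraph" +
  triangles :: "'v set set"

text \<open>Residue classes modulo \<open>r\<close> and \<open>s\<close> are represented by the numbers below \<open>r\<close> and \<open>s\<close>.
  For \<open>r \<ge> 3\<close> and \<open>s \<ge> 3\<close> the edges below are two-element sets.\<close>

definition torus_triangulation :: "nat \<Rightarrow> nat \<Rightarrow> (nat \<times> nat) triangulation" where
  "torus_triangulation r s =
     \<lparr> verts = {..<r} \<times> {..<s},
       edges =
         (\<Union>(x, y) \<in> {..<r} \<times> {..<s}.
           {{(x, y), ((x + 1) mod r, y)},
            {(x, y), (x, (y + 1) mod s)},
            {(x, y), ((x + 1) mod r, (y + 1) mod s)}}),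
       triangles =
         (\<Union>(x, y) \<in> {..<r} \<times> {..<s}.
           {{(x, y), ((x + 1) mod r, y), ((x + 1) mod r, (y + 1) mod s)},
            {(x, y), (x, (y + 1) mod s), ((x + 1) mod r, (y + 1) mod s)}}) \<rparr>"

definition induced_subgraph :: "('v, 'm) ugraph_scheme \<Rightarrow> 'v set \<Rightarrow> 'v ugraph" where
  "induced_subgraph G S =
     \<lparr> verts = verts G \<inter> S, edges = {e \<in> edges G. e \<subseteq> verts G \<inter> S} \<rparr>"

definition connected_components :: "('v, 'm) ugraph_scheme \<Rightarrow> 'v set set" where
  "connected_components G = verts G // ({(u, v). {u, v} \<in> edges G}\<^sup>* \<inter> verts G \<times> verts G)"

text \<open>Colorings are extensional functions, i.e. fixed to be \<^const>\<open>undefined\<close> off the vertex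
  set, so that distinct colorings differ at some vertex.\<close>

definition colorings :: "('v, 'm) ugraph_scheme \<Rightarrow> nat \<Rightarrow> ('v \<Rightarrow> nat) set" where
  "colorings G k =
     {f \<in> verts G \<rightarrow>\<^sub>E {1..k}. \<forall>u v. {u, v} \<in> edges G \<longrightarrow> f u \<noteq> f v}"

definition kempe_change ::
    "('v, 'm) ugraph_scheme \<Rightarrow> nat \<Rightarrow> (('v \<Rightarrow> nat) \<times> ('v \<Rightarrow> nat)) set" where
  "kempe_change G k =
     {(f, g). \<exists>a \<in> {1..k}. \<exists>b \<in> {1..k}. a \<noteq> b \<and>
        (\<exists>C \<in> connected_components (induced_subgraph G {v. f v = a \<or> f v = b}).
           g = (\<lambda>v. if v \<in> C then transpose a b (f v) else f v))}"

definition kempe_equivalent ::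
    "('v, 'm) ugraph_scheme \<Rightarrow> nat \<Rightarrow> (('v \<Rightarrow> nat) \<times> ('v \<Rightarrow> nat)) set" where
  "kempe_equivalent G k = (kempe_change G k)\<^sup>* \<inter> colorings G k \<times> colorings G k"

definition color_permuted ::
    "('v, 'm) ugraph_scheme \<Rightarrow> nat \<Rightarrow> (('v \<Rightarrow> nat) \<times> ('v \<Rightarrow> nat)) set" where
  "color_permuted G k =
     {(f, g) \<in> colorings G k \<times> colorings G k.
        \<exists>\<pi>. \<pi> permutes {1..k} \<and> g = (\<lambda>v \<in> verts G. \<pi> (f v))}"

text \<open>The transitive closure of the union is the smallest equivalence relation on the colorings
  that contains Kempe equivalence and identifies colorings up to a permutation of the colors.\<close>

definition kappa :: "('v, 'm) ugraph_scheme \<Rightarrow> nat \<Rightarrow> nat" where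
  "kappa G k = card (colorings G k // (kempe_equivalent G k \<union> color_permuted G k)\<^sup>+)"

end

theory Submission
  imports Defs
begin

text \<open>Call a vertex antipodal for a coloring if opposite neighbors have equal colors. In a 4-coloring
  of a 6-regular triangulated torus, the link of a vertex of color \<open>a\<close> is a closed walk of length 6
  on the triangle of the other three colors; its winding number is 0, or \<open>\<plusminus>2\<close> exactly at antipodal
  vertices. Counting winding numbers by the edges between two color classes \<open>a\<close> and \<open>b\<close> shows that
  the number of antipodal vertices of a color has the same parity for all four colors, and that
  the same holds inside each connected \<open>ab\<close>-component. Hence this parity does not change under Kempe
  changes. It is even for the 3-coloring \<open>x + y mod 3\<close>, so a coloring with odd parity suffices.\<close>

section \<open>Closed walks of length 6 on a triangle\<close>

definition swap_sign :: "'c \<Rightarrow> 'c \<Rightarrow> 'c \<Rightarrow> 'c \<Rightarrow> int" where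
  "swap_sign c d x y = (if x = c \<and> y = d then 1 else if x = d \<and> y = c then -1 else 0)"

lemma swap_sign_flip: "c \<noteq> d \<Longrightarrow> swap_sign c d y x = - swap_sign c d x y"
  by (auto simp: swap_sign_def)

text \<open>Summed over a closed walk on the triangle \<open>b\<close>, \<open>c\<close>,
  \<open>d\<close>, the passages through \<open>b\<close> from \<open>c\<close> to \<open>d\<close>
  minus those back give the winding number; turning back at \<open>b\<close> counts 0.\<close>

definition signed_passage :: "'c \<Rightarrow> 'c \<Rightarrow> 'c \<Rightarrow> 'c \<Rightarrow> 'c \<Rightarrow> 'c \<Rightarrow> int" where
  "signed_passage b c d x y z = (if y = b then swap_sign c d x z else 0)"

text \<open>Six steps of +-1 around a triangle that close up sum to an even multiple of 3, so to 0
  or +-6. Six equal steps make opposite entries equal; conversely, equal opposite entries make both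
  halves close up with the same odd sum, which excludes 0. So the winding number is 0 or +-2, and
  both signs are 2 mod 4. The 66 closed walks are evaluated directly.\<close>

lemma hexagon_passages_nat:
  "\<forall>x0\<in>{0, 1, 2 :: nat}. \<forall>x1\<in>{0, 1, 2}. x0 \<noteq> x1 \<longrightarrow> (\<forall>x2\<in>{0, 1, 2}. x1 \<noteq> x2 \<longrightarrow>
    (\<forall>x3\<in>{0, 1, 2}. x2 \<noteq> x3 \<longrightarrow> (\<forall>x4\<in>{0, 1, 2}. x3 \<noteq> x4 \<longrightarrow>
    (\<forall>x5\<in>{0, 1, 2}. x4 \<noteq> x5 \<longrightarrow> x5 \<noteq> x0 \<longrightarrow>
      (signed_passage 0 1 2 x5 x0 x1 + signed_passage 0 1 2 x0 x1 x2
        + signed_passage 0 1 2 x1 x2 x3 + signed_passage 0 1 2 x2 x3 x4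
        + signed_passage 0 1 2 x3 x4 x5 + signed_passage 0 1 2 x4 x5 x0) mod 4
      = (if x0 = x3 \<and> x1 = x4 \<and> x2 = x5 then 2 else 0)))))"
  by code_simp

lemma hexagon_passages:
  assumes bcd: "b \<noteq> c" "b \<noteq> d" "c \<noteq> d"
    and x: "x0 \<in> {b, c, d}" "x1 \<in> {b, c, d}" "x2 \<in> {b, c, d}"
      "x3 \<in> {b, c, d}" "x4 \<in> {b, c, d}" "x5 \<in> {b, c, d}"
    and ne: "x0 \<noteq> x1" "x1 \<noteq> x2" "x2 \<noteq> x3" "x3 \<noteq> x4" "x4 \<noteq> x5" "x5 \<noteq> x0"
  shows "(signed_passage b c d x5 x0 x1 + signed_passage b c d x0 x1 x2
      + signed_passage b c d x1 x2 x3 + signed_passage b c d x2 x3 x4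
      + signed_passage b c d x3 x4 x5 + signed_passage b c d x4 x5 x0) mod 4
    = (if x0 = x3 \<and> x1 = x4 \<and> x2 = x5 then 2 else 0)"
proof -
  \<comment> \<open>Signed passages depend only on equalities between colors, so the injective
    renaming of \<open>b\<close>, \<open>c\<close>, \<open>d\<close> to 0, 1, 2 preserves
    them.\<close>
  define e where "e y = (if y = b then 0 else if y = c then 1 else 2 :: nat)" for y
  have e_values: "e b = 0" "e c = 1" "e d = 2"
    using bcd by (simp_all add: e_def)
  have e_eq: "e y = e z \<longleftrightarrow> y = z" if "y \<in> {b, c, d}" "z \<in> {b, c, d}" for y z
    using that bcd e_values by (metis empty_iff insert_iff zero_neq_numeral zero_neq_one num.distinct(1) one_eq_numeral_iff)
  have e_in: "e y \<in> {0, 1, 2}" for y by (simp add: e_def)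
  have e_passage: "signed_passage 0 1 2 (e y) (e z) (e w) = signed_passage b c d y z w"
    if "y \<in> {b, c, d}" "z \<in> {b, c, d}" "w \<in> {b, c, d}" for y z w
    unfolding signed_passage_def swap_sign_def
    using that e_eq[of z b] e_eq[of y c] e_eq[of y d] e_eq[of w c] e_eq[of w d]
    by (simp add: e_values)
  note hexagon_passages_nat[THEN bspec, OF e_in[of x0], THEN bspec, OF e_in[of x1],
      THEN mp, THEN bspec, OF _ e_in[of x2], THEN mp, THEN bspec, OF _ _ e_in[of x3],
      THEN mp, THEN bspec, OF _ _ _ e_in[of x4], THEN mp, THEN bspec, OF _ _ _ _ e_in[of x5],
      THEN mp, THEN mp]
  then show ?thesis
    unfolding e_passage[OF x(6,1,2)] e_passage[OF x(1,2,3)] e_passage[OF x(2,3,4)]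
      e_passage[OF x(3,4,5)] e_passage[OF x(4,5,6)] e_passage[OF x(5,6,1)]
      e_eq[OF x(1,2)] e_eq[OF x(2,3)] e_eq[OF x(3,4)] e_eq[OF x(4,5)] e_eq[OF x(5,6)]
      e_eq[OF x(6,1)] e_eq[OF x(1,4)] e_eq[OF x(2,5)] e_eq[OF x(3,6)]
    using ne by blast
qed

section \<open>The parity invariant of four-colorings\<close>

text \<open>\<open>n k v\<close> is the neighbor of \<open>v\<close> in direction \<open>k\<close>,
  with six directions in cyclic order; \<open>n_left\<close> closes the triangle on
  \<open>v\<close>, \<open>n k v\<close> and \<open>n (k + 1) v\<close>. The link is read as a
  closed walk, so neighbors in different directions may coincide.\<close>

locale hexagonal_triangulation =
  fixes G :: "('v, 'm) ugraph_scheme" and n :: "nat \<Rightarrow> 'v \<Rightarrow> 'v"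
  assumes finite_verts: "finite (verts G)"
    and edge_iff: "{u, v} \<in> edges G \<longleftrightarrow> u \<in> verts G \<and> (\<exists>k. v = n k u)"
    and n_verts: "v \<in> verts G \<Longrightarrow> n k v \<in> verts G"
    and n_opposite: "v \<in> verts G \<Longrightarrow> n (k + 3) (n k v) = v"
    and n_left: "v \<in> verts G \<Longrightarrow> n (k + 2) (n k v) = n (k + 1) v"
    and n_period: "n (k + 6) v = n k v"
begin

text \<open>The triangle on the other side of the edge: direction \<open>k + 1\<close> leads from
  \<open>n (k + 5) v\<close> to \<open>n k v\<close>, and \<open>k + 4\<close> leads back.\<close>

lemma n_right: "v \<in> verts G \<Longrightarrow> n (k + 4) (n k v) = n (k + 5) v"
proof -
  assume v: "v \<in> verts G"
  have "n (k + 5 + 2) (n (k + 5) v) = n (k + 5 + 1) v" by (rule n_left[OF v])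
  then have "n (k + 1) (n (k + 5) v) = n k v"
    using n_period[of "k + 1" "n (k + 5) v"] n_period[of k v] by (simp add: ac_simps)
  moreover have "n (k + 1 + 3) (n (k + 1) (n (k + 5) v)) = n (k + 5) v"
    by (rule n_opposite[OF n_verts[OF v]])
  ultimately show ?thesis by (simp add: ac_simps)
qed

definition antipodal :: "('v \<Rightarrow> 'c) \<Rightarrow> 'v \<Rightarrow> bool" where
  "antipodal f v \<longleftrightarrow> f (n 0 v) = f (n 3 v) \<and> f (n 1 v) = f (n 4 v) \<and> f (n 2 v) = f (n 5 v)"

definition antipodal_count :: "('v \<Rightarrow> 'c) \<Rightarrow> 'c \<Rightarrow> nat" where
  "antipodal_count f a = card {v \<in> verts G. f v = a \<and> antipodal f v}"

lemma coloring_iff: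
  "f \<in> colorings G m \<longleftrightarrow> f \<in> extensional (verts G) \<and>
    (\<forall>v \<in> verts G. f v \<in> {1..m} \<and> (\<forall>k. f (n k v) \<noteq> f v))"
proof -
  have "(\<forall>u v. {u, v} \<in> edges G \<longrightarrow> f u \<noteq> f v) \<longleftrightarrow> (\<forall>v \<in> verts G. \<forall>k. f (n k v) \<noteq> f v)"
    unfolding edge_iff by (auto simp: eq_commute)
  then show ?thesis by (auto simp: colorings_def PiE_iff simp del: atLeastAtMost_iff)
qed

lemma coloring_nbr:
  assumes f: "f \<in> colorings G m" and v: "v \<in> verts G"
  shows "f (n k v) \<in> {1..m}" and "f (n k v) \<noteq> f v"
proof -
  have c: "\<forall>v \<in> verts G. f v \<in> {1..m} \<and> (\<forall>k. f (n k v) \<noteq> f v)"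
    using f unfolding coloring_iff by (rule conjunct2)
  show "f (n k v) \<in> {1..m}" using bspec[OF c n_verts[OF v]] by (rule conjunct1)
  show "f (n k v) \<noteq> f v" using bspec[OF c v] by (rule conjunct2[THEN spec])
qed

text \<open>The share of neighbor \<open>k\<close> in the winding number of the link of
  \<open>v\<close>; \<open>k + 5\<close> stands for \<open>k - 1\<close>. It is nonzero only on an
  edge to color \<open>b\<close> with \<open>c\<close> on one side and \<open>d\<close> on the
  other.\<close>

definition passage :: "('v \<Rightarrow> nat) \<Rightarrow> nat \<Rightarrow> nat \<Rightarrow> nat \<Rightarrow> nat \<Rightarrow> 'v \<Rightarrow> int" where
  "passage f b c d k v = signed_passage b c d (f (n (k + 5) v)) (f (n k v)) (f (n (k + 1) v))"

lemma sum_passage: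
  assumes f: "f \<in> colorings G 4" and v: "v \<in> verts G" and abcd: "{1..4} = {f v, b, c, d}"
    and "b \<noteq> c" "b \<noteq> d" "c \<noteq> d"
  shows "(\<Sum>k<6. passage f b c d k v) mod 4 = (if antipodal f v then 2 else 0)"
proof -
  have x: "f (n k v) \<in> {b, c, d}" for k
    using coloring_nbr[OF f v, of k] unfolding abcd by simp
  \<comment> \<open>Consecutive neighbors are adjacent, by \<open>n_left\<close>.\<close>
  have ne: "f (n k v) \<noteq> f (n (k + 1) v)" for k
    using coloring_nbr(2)[OF f n_verts[OF v], of "k + 2" k] n_left[OF v, of k] by simp
  have e: "f (n 5 v) \<noteq> f (n 0 v)"
    using ne[of 5] n_period[of 0 v] by simp
  have p: "n 10 v = n 4 v" "n 9 v = n 3 v" "n 8 v = n 2 v" "n 7 v = n 1 v" "n 6 v = n 0 v"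
    using n_period[of 4 v] n_period[of 3 v] n_period[of 2 v] n_period[of 1 v] n_period[of 0 v]
    by simp_all
  have "(\<Sum>k<6. passage f b c d k v) = (\<Sum>k\<in>{0, 1, 2, 3, 4, 5}. passage f b c d k v)"
    by (rule sum.cong) auto
  then show ?thesis
    using hexagon_passages[OF assms(4-6) x[of 0] x[of 1] x[of 2] x[of 3] x[of 4] x[of 5]]
      ne[of 0] ne[of 1] ne[of 2] ne[of 3] ne[of 4] e p
    by (simp add: passage_def antipodal_def add.assoc del: One_nat_def)
qed

text \<open>Reversing an edge swaps its two sides, so the passages along the two orientations of an edge
  cancel; mod 4, each antipodal vertex contributes 2.\<close>

lemma antipodal_balanced:
  assumes f: "f \<in> colorings G 4" and ab: "a \<in> {1..4}" "b \<in> {1..4}" "a \<noteq> b"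
    and S: "S \<subseteq> verts G"
    and closed: "\<And>v k. v \<in> S \<Longrightarrow> f (n k v) \<in> {a, b} \<Longrightarrow> n k v \<in> S"
  shows "even (card {v \<in> S. f v = a \<and> antipodal f v} + card {v \<in> S. f v = b \<and> antipodal f v})"
proof -
  have fin: "finite S" using S finite_verts finite_subset by blast
  have "card ({1..4} - {a, b}) = 2" using ab by (simp add: card_Diff_subset)
  then obtain c d where cd: "{1..4} - {a, b} = {c, d}" "c \<noteq> d" by (auto simp: card_2_iff)
  have A: "{1..4} = {a, b, c, d}" using cd ab by blast
  have B: "{1..4} = {b, a, c, d}" using A by blast
  have ne: "a \<noteq> c" "a \<noteq> d" "b \<noteq> c" "b \<noteq> d" using cd by auto
  \<comment> \<open>The total winding number of the links of the vertices of \<open>S\<close>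
    colored \<open>a\<close>, counted at their neighbors colored \<open>b\<close>. The order of
    \<open>c\<close> and \<open>d\<close> is the same for \<open>I a b\<close> and
    \<open>I b a\<close>.\<close>
  define I where "I a b = (\<Sum>v\<in>{v \<in> S. f v = a}. \<Sum>k<6. passage f b c d k v)" for a b
  have I_mod: "I a b mod 4 = 2 * int (card {v \<in> S. f v = a \<and> antipodal f v}) mod 4"
    if "{1..4} = {a, b, c, d}" "b \<noteq> c" "b \<noteq> d" for a b
  proof -
    have "I a b mod 4 = (\<Sum>v\<in>{v \<in> S. f v = a}. (\<Sum>k<6. passage f b c d k v) mod 4) mod 4"
      unfolding I_def by (simp add: mod_sum_eq)
    also have "(\<Sum>v\<in>{v \<in> S. f v = a}. (\<Sum>k<6. passage f b c d k v) mod 4)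
        = (\<Sum>v\<in>{v \<in> S. f v = a}. if antipodal f v then 2 else 0)"
      using S that cd(2) by (intro sum.cong refl sum_passage[OF f]) auto
    also have "\<dots> = 2 * int (card {v \<in> S. f v = a \<and> antipodal f v})"
      using fin by (simp add: sum.If_cases Collect_conj_eq Int_assoc)
    finally show ?thesis .
  qed
  have I_swap: "I a b = - I b a"
  proof -
    \<comment> \<open>The same sum restricted to edges from color \<open>a\<close> to color
      \<open>b\<close> in direction \<open>k\<close>.\<close>
    define J where "J a b k = (\<Sum>v\<in>{v \<in> S. f v = a \<and> f (n k v) = b}.
      swap_sign c d (f (n (k + 5) v)) (f (n (k + 1) v)))" for a b k
    have IJ: "I a b = (\<Sum>k<6. J a b k)" for a b
    proof -
      have "(\<Sum>v\<in>{v \<in> S. f v = a}. passage f b c d k v) = J a b k" for k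
        unfolding J_def passage_def signed_passage_def using fin
        by (subst sum.inter_filter[symmetric]) (auto intro!: sum.cong)
      then show ?thesis unfolding I_def by (subst sum.swap) simp
    qed
    \<comment> \<open>The map \<open>n k\<close> sends the \<open>a\<close>-end of such an edge to
      its \<open>b\<close>-end, which lies in \<open>S\<close> by \<open>closed\<close>. Seen from
      there the direction is \<open>k + 3\<close> and the two sides are exchanged, so the sign
      flips.\<close>
    have JJ: "J a b k = - J b a (k + 3)" for k
    proof -
      have inv_step: "n k (n (k + 3) u) = u" if "u \<in> S" for u
        using n_opposite[of u "k + 3"] n_period[of k] that S by (auto simp: add.assoc)
      have "J a b k = (\<Sum>u\<in>{v \<in> S. f v = b \<and> f (n (k + 3) v) = a}.
          swap_sign c d (f (n (k + 4) u)) (f (n (k + 2) u)))"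
        unfolding J_def
      proof (rule sum.reindex_bij_witness[of _ "n (k + 3)" "n k"], goal_cases)
        case (5 v)
        then show ?case using n_right[of v k] n_left[of v k] S by auto
      qed (use S closed inv_step n_opposite in auto)
      also have "\<dots> = - J b a (k + 3)"
        unfolding J_def
        by (subst swap_sign_flip[OF cd(2)])
          (use n_period[of "k + 2"] in \<open>simp add: sum_negf ac_simps\<close>)
      finally show ?thesis .
    qed
    have J6: "J a b (k + 6) = J a b k" for a b k
      using n_period[of k] n_period[of "k + 5"] n_period[of "k + 1"]
      by (simp add: J_def add.assoc add.commute[of 6])
    have six: "(\<Sum>k<6. h k) = h 0 + h 1 + h 2 + h 3 + h 4 + h 5" for h :: "nat \<Rightarrow> int"
      by (simp add: eval_nat_numeral)
    \<comment> \<open>Directions 3, 4, 5 are carried to 6, 7, 8, which \<open>J6\<close> identifies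
      with 0, 1, 2.\<close>
    show ?thesis
      unfolding IJ six
      using JJ[of 0] JJ[of 1] JJ[of 2] JJ[of 3] JJ[of 4] JJ[of 5]
        J6[of b a 0] J6[of b a 1] J6[of b a 2] by simp
  qed
  have I_swap': "I b a = - I a b" using I_swap by simp
  \<comment> \<open>The two congruences add up to \<open>2 * (m + k)\<close> being 0 mod 4.\<close>
  have arith: "even (m + k)" if "i mod 4 = 2 * int m mod 4" "- i mod 4 = 2 * int k mod 4" for i m k
    using that by presburger
  show ?thesis
    using arith[OF I_mod[OF A ne(3,4)] I_mod[OF B ne(1,2), unfolded I_swap']] .
qed

text \<open>The balance is applied to all vertices of color \<open>a\<close> or \<open>b\<close>, a
  set that is trivially closed.\<close>

lemma antipodal_count_parity:
  assumes f: "f \<in> colorings G 4" and "a \<in> {1..4}" "b \<in> {1..4}"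
  shows "even (antipodal_count f a) \<longleftrightarrow> even (antipodal_count f b)"
proof (cases "a = b")
  case False
  let ?S = "{v \<in> verts G. f v \<in> {a, b}}"
  have "{v \<in> ?S. f v = c \<and> antipodal f v} = {v \<in> verts G. f v = c \<and> antipodal f v}"
    if "c \<in> {a, b}" for c
    using that by auto
  moreover have "even (card {v \<in> ?S. f v = a \<and> antipodal f v}
      + card {v \<in> ?S. f v = b \<and> antipodal f v})"
    using assms False by (intro antipodal_balanced[OF f]) (simp_all add: n_verts subset_iff)
  ultimately show ?thesis by (simp add: antipodal_count_def)
qed simp

lemma component_closed:
  assumes C: "C \<in> connected_components (induced_subgraph G T)"
  shows "C \<subseteq> verts G \<inter> T" and "v \<in> C \<Longrightarrow> n k v \<in> T \<Longrightarrow> n k v \<in> C"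
proof -
  let ?H = "induced_subgraph G T"
  obtain u where u: "u \<in> verts ?H"
    and Ceq: "C = ({(u, v). {u, v} \<in> edges ?H}\<^sup>* \<inter> verts ?H \<times> verts ?H) `` {u}"
    using C unfolding connected_components_def by (rule quotientE)
  show sub: "C \<subseteq> verts G \<inter> T"
    unfolding Ceq by (auto simp: induced_subgraph_def)
  assume v: "v \<in> C" and k: "n k v \<in> T"
  have "{v, n k v} \<in> edges ?H" "n k v \<in> verts ?H"
    using sub v k edge_iff[of v "n k v"] n_verts by (auto simp: induced_subgraph_def)
  then show "n k v \<in> C"
    using v unfolding Ceq by (auto intro: rtrancl_into_rtrancl)
qed

text \<open>At a vertex of color \<open>a\<close> or \<open>b\<close> the link is transposed as a
  whole (inside \<open>C\<close>) or left alone (outside), so antipodality is kept there. The count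
  for \<open>a\<close> thus trades the antipodal \<open>a\<close>-vertices of \<open>C\<close> for
  the antipodal \<open>b\<close>-vertices of \<open>C\<close>, whose numbers have equal parity by
  \<open>antipodal_balanced\<close> with \<open>S\<close> as \<open>C\<close>. The other two colors
  may change antipodality, but their parity is tied to that of \<open>a\<close> in both
  colorings.\<close>

lemma kempe_change_parity:
  assumes fg: "(f, g) \<in> kempe_change G 4" and f: "f \<in> colorings G 4"
  shows "g \<in> colorings G 4 \<and> (\<forall>e \<in> {1..4}. even (antipodal_count g e) \<longleftrightarrow> even (antipodal_count f e))"
proof -
  obtain a b C where ab: "a \<in> {1..4}" "b \<in> {1..4}" "a \<noteq> b"
    and C: "C \<in> connected_components (induced_subgraph G {v. f v = a \<or> f v = b})"
    and g: "g = (\<lambda>v. if v \<in> C then transpose a b (f v) else f v)"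
    using fg unfolding kempe_change_def by blast
  have CV: "v \<in> verts G" "f v \<in> {a, b}" if "v \<in> C" for v
    using component_closed(1)[OF C] that by auto
  have step: "n k v \<in> C" if "v \<in> C" "f (n k v) \<in> {a, b}" for v k
    using component_closed(2)[OF C that(1), of k] that(2) by simp
  have inv_step: "v \<in> C" if "n k v \<in> C" "v \<in> verts G" "f v \<in> {a, b}" for v k
    using step[OF that(1), of "k + 3"] n_opposite[OF that(2)] that(3) by simp
  have nbr: "g (n k v) \<noteq> g v" if v: "v \<in> verts G" for k v
  proof -
    have "f (n k v) \<noteq> f v" by (rule coloring_nbr(2)[OF f v])
    then show ?thesis
      using step[of v k] inv_step[of k v] v CV[of v] CV[of "n k v"]
      by (auto simp: g transpose_def split: if_splits)
  qed
  have "f v \<in> {1..4}" if "v \<in> verts G" for v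
    using f that by (simp add: coloring_iff)
  then have "g v \<in> {1..4}" if "v \<in> verts G" for v
    using that ab unfolding g transpose_def by (simp del: atLeastAtMost_iff)
  moreover have "g \<in> extensional (verts G)"
    using f CV(1) by (auto simp: coloring_iff g extensional_def)
  ultimately have gc: "g \<in> colorings G 4"
    using nbr by (simp add: coloring_iff)
  have link: "antipodal g v \<longleftrightarrow> antipodal f v" if v: "v \<in> verts G" "f v \<in> {a, b}" for v
  proof (cases "v \<in> C")
    case True
    have "g (n k v) = transpose a b (f (n k v))" for k
      using step[OF True, of k] by (auto simp: g transpose_def)
    then show ?thesis
      by (simp add: antipodal_def inj_eq[OF inj_transpose])
  next
    case False
    then have "g (n k v) = f (n k v)" for k
      using inv_step[OF _ v, of k] by (auto simp: g)
    then show ?thesis by (simp add: antipodal_def)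
  qed
  let ?A = "\<lambda>c. {v \<in> C. f v = c \<and> antipodal f v}"
  let ?O = "{v \<in> verts G - C. f v = a \<and> antipodal f v}"
  have CV': "C \<subseteq> verts G" using CV(1) by (rule subsetI)
  then have finC: "finite C" using finite_verts by (rule finite_subset)
  have "{v \<in> verts G. g v = a \<and> antipodal g v} = ?O \<union> ?A b"
  proof (intro set_eqI)
    fix v
    consider "v \<in> C" "f v = a" | "v \<in> C" "f v = b" | "v \<notin> C" using CV(2)[of v] by blast
    then show "v \<in> {v \<in> verts G. g v = a \<and> antipodal g v} \<longleftrightarrow> v \<in> ?O \<union> ?A b"
      using ab link[of v] CV[of v] by cases (auto simp: g)
  qed
  then have ga: "antipodal_count g a = card ?O + card (?A b)"
    unfolding antipodal_count_def using finC finite_verts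
    by (simp only:) (subst card_Un_disjoint; auto)
  have "{v \<in> verts G. f v = a \<and> antipodal f v} = ?O \<union> ?A a"
    using CV' by blast
  then have fa: "antipodal_count f a = card ?O + card (?A a)"
    unfolding antipodal_count_def using finC finite_verts
    by (simp only:) (subst card_Un_disjoint; auto)
  have "even (card (?A a) + card (?A b))"
    by (rule antipodal_balanced[OF f ab CV' step])
  then have "even (antipodal_count g a) \<longleftrightarrow> even (antipodal_count f a)"
    unfolding ga fa by auto
  then show ?thesis
    using gc antipodal_count_parity[OF f _ ab(1)] antipodal_count_parity[OF gc _ ab(1)] by blast
qed

text \<open>The count for color 1 becomes the count for \<open>\<pi> 1\<close>, and all colors of
  one coloring share their parity.\<close>

lemma color_permuted_parity:
  assumes fg: "(f, g) \<in> color_permuted G 4"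
  shows "even (antipodal_count g 1) \<longleftrightarrow> even (antipodal_count f 1)"
proof -
  obtain \<pi> where f: "f \<in> colorings G 4" and gc: "g \<in> colorings G 4"
    and pi: "\<pi> permutes {1..4}" and g: "g = (\<lambda>v \<in> verts G. \<pi> (f v))"
    using fg unfolding color_permuted_def by blast
  have "antipodal g v \<longleftrightarrow> antipodal f v" if "v \<in> verts G" for v
    using that n_verts[OF that] by (simp add: antipodal_def g inj_eq[OF permutes_inj[OF pi]])
  then have "{v \<in> verts G. g v = \<pi> 1 \<and> antipodal g v} = {v \<in> verts G. f v = 1 \<and> antipodal f v}"
    by (auto simp: g inj_eq[OF permutes_inj[OF pi]])
  then have "antipodal_count g (\<pi> 1) = antipodal_count f 1"
    by (simp add: antipodal_count_def)
  moreover have "\<pi> 1 \<in> {1..4}" using permutes_in_image[OF pi] by simp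
  ultimately show ?thesis using antipodal_count_parity[OF gc, of 1 "\<pi> 1"] by simp
qed

lemma kempe_equivalent_parity:
  assumes "(f, g) \<in> kempe_equivalent G 4"
  shows "even (antipodal_count g 1) \<longleftrightarrow> even (antipodal_count f 1)"
proof -
  have fg: "(f, g) \<in> (kempe_change G 4)\<^sup>*" and f: "f \<in> colorings G 4"
    using assms by (auto simp: kempe_equivalent_def)
  from fg have "g \<in> colorings G 4 \<and> (even (antipodal_count g 1) \<longleftrightarrow> even (antipodal_count f 1))"
  proof induction
    case (step g h)
    then show ?case using kempe_change_parity[of g h] by auto
  qed (use f in simp)
  then show ?thesis by simp
qed

text \<open>The parity for color 1 is constant on classes; parities for \<open>c\<close> and
  \<open>d\<close> are converted to it within each coloring.\<close>

theorem kappa_ge_2: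
  assumes f: "f \<in> colorings G 4" and g: "g \<in> colorings G 4"
    and c: "c \<in> {1..4}" and d: "d \<in> {1..4}"
    and par: "even (antipodal_count f c)" "odd (antipodal_count g d)"
  shows "kappa G 4 \<ge> 2"
proof -
  let ?T = "(kempe_equivalent G 4 \<union> color_permuted G 4)\<^sup>+"
  have inv: "even (antipodal_count w 1) \<longleftrightarrow> even (antipodal_count u 1)" if "(u, w) \<in> ?T" for u w
    using that by induction (use kempe_equivalent_parity color_permuted_parity in blast)+
  have "(f, f) \<in> ?T" using f by (intro r_into_trancl) (simp add: kempe_equivalent_def)
  moreover have "(g, f) \<notin> ?T"
    using inv[of g f] par antipodal_count_parity[OF f c, of 1] antipodal_count_parity[OF g d, of 1]
    by auto
  ultimately have "?T `` {f} \<noteq> ?T `` {g}" by blast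
  then have "card {?T `` {f}, ?T `` {g}} = 2" by simp
  moreover have "{?T `` {f}, ?T `` {g}} \<subseteq> colorings G 4 // ?T"
    using f g by (auto intro: quotientI)
  \<comment> \<open>An infinite set has \<open>card\<close> 0, so two distinct classes bound
    \<open>kappa\<close> only once finiteness is known.\<close>
  moreover have "finite (colorings G 4 // ?T)"
  proof -
    have "finite (colorings G 4)"
      by (rule finite_subset[of _ "verts G \<rightarrow>\<^sub>E {1..4}"])
        (auto simp: colorings_def intro: finite_PiE finite_verts)
    then show ?thesis by (simp add: quotient_def)
  qed
  ultimately show ?thesis unfolding kappa_def by (metis card_mono)
qed

end

section \<open>The torus as a hexagonal triangulation\<close>

definition cyc_succ :: "nat \<Rightarrow> nat \<Rightarrow> nat" where
  "cyc_succ r x = (x + 1) mod r"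

text \<open>Adding \<open>r\<close> first keeps the subtraction from truncating at 0.\<close>

definition cyc_pred :: "nat \<Rightarrow> nat \<Rightarrow> nat" where
  "cyc_pred r x = (x + r - 1) mod r"

lemma cyc_less:
  assumes "x < r"
  shows "cyc_succ r x < r" "cyc_pred r x < r"
  using assms by (simp_all add: cyc_succ_def cyc_pred_def)

lemma cyc_succ_eq: "x < r \<Longrightarrow> cyc_succ r x = (if x + 1 = r then 0 else x + 1)"
  by (simp add: cyc_succ_def)

lemma cyc_pred_eq: "x < r \<Longrightarrow> cyc_pred r x = (if x = 0 then r - 1 else x - 1)"
  by (cases x) (simp_all add: cyc_pred_def)

lemma cyc_inverse:
  assumes "x < r"
  shows "cyc_pred r (cyc_succ r x) = x" "cyc_succ r (cyc_pred r x) = x"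
  using assms cyc_less[OF assms] by (auto simp: cyc_succ_eq cyc_pred_eq)

lemma cyc_mod:
  assumes "m dvd r" "x < r"
  shows "cyc_succ r x mod m = (x + 1) mod m" "(cyc_pred r x + 1) mod m = x mod m"
proof -
  show "cyc_succ r x mod m = (x + 1) mod m"
    unfolding cyc_succ_def by (rule mod_mod_cancel[OF assms(1)])
  have "(cyc_pred r x + 1) mod m = (cyc_pred r x + 1) mod r mod m"
    by (rule mod_mod_cancel[OF assms(1), symmetric])
  also have "\<dots> = x mod m"
    by (simp only: cyc_inverse(2)[OF assms(2), unfolded cyc_succ_def])
  finally show "(cyc_pred r x + 1) mod m = x mod m" .
qed

text \<open>The six neighbours of a vertex in counterclockwise order, starting with \<open>(x + 1, y)\<close>.\<close>

definition torus_nbr :: "nat \<Rightarrow> nat \<Rightarrow> nat \<Rightarrow> nat \<times> nat \<Rightarrow> nat \<times> nat" where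
  "torus_nbr r s k = (\<lambda>(x, y).
    (if k mod 6 \<in> {0, 1} then cyc_succ r x else if k mod 6 \<in> {3, 4} then cyc_pred r x else x,
     if k mod 6 \<in> {1, 2} then cyc_succ s y else if k mod 6 \<in> {4, 5} then cyc_pred s y else y))"

text \<open>This reduces identities in all directions to the six directions below 6.\<close>

lemma torus_nbr_mod: "torus_nbr r s (k mod 6 + j) = torus_nbr r s (k + j)"
  unfolding torus_nbr_def mod_add_left_eq by (rule refl)

lemma mod_6_cases: "(k :: nat) mod 6 \<in> {0, 1, 2, 3, 4, 5}"
  using mod_less_divisor[of 6 k] by auto

lemma torus_verts: "verts (torus_triangulation r s) = {..<r} \<times> {..<s}"
  by (simp add: torus_triangulation_def)

lemma torus_edge_iff:
  "e \<in> edges (torus_triangulation r s) \<longleftrightarrow>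
    (\<exists>x<r. \<exists>y<s. e = {(x, y), (cyc_succ r x, y)} \<or> e = {(x, y), (x, cyc_succ s y)}
      \<or> e = {(x, y), (cyc_succ r x, cyc_succ s y)})"
  by (auto simp: torus_triangulation_def cyc_succ_def)

lemma torus_nbr_opposite:
  assumes "v \<in> {..<r} \<times> {..<s}"
  shows "torus_nbr r s (k + 3) (torus_nbr r s k v) = v"
proof -
  obtain x y where v: "v = (x, y)" "x < r" "y < s" using assms by blast
  \<comment> \<open>\<open>j + 0\<close> has the shape that \<open>torus_nbr_mod\<close>
    rewrites.\<close>
  have "torus_nbr r s (j + 3) (torus_nbr r s (j + 0) v) = v" if "j \<in> {0, 1, 2, 3, 4, 5}" for j
    using that v by (elim insertE emptyE) (simp_all add: torus_nbr_def cyc_inverse)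
  from this[OF mod_6_cases[of k]] show ?thesis
    unfolding torus_nbr_mod by simp
qed

lemma torus_nbr_left:
  assumes "v \<in> {..<r} \<times> {..<s}"
  shows "torus_nbr r s (k + 2) (torus_nbr r s k v) = torus_nbr r s (k + 1) v"
proof -
  obtain x y where v: "v = (x, y)" "x < r" "y < s" using assms by blast
  have "torus_nbr r s (j + 2) (torus_nbr r s (j + 0) v) = torus_nbr r s (j + 1) v"
    if "j \<in> {0, 1, 2, 3, 4, 5}" for j
    using that v by (elim insertE emptyE) (simp_all add: torus_nbr_def cyc_inverse)
  from this[OF mod_6_cases[of k]] show ?thesis
    unfolding torus_nbr_mod by simp
qed

lemma torus_nbr_verts:
  assumes "v \<in> {..<r} \<times> {..<s}"
  shows "torus_nbr r s k v \<in> {..<r} \<times> {..<s}"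
  using assms by (auto simp: torus_nbr_def cyc_less)

lemma torus_edge_iff_forward:
  "e \<in> edges (torus_triangulation r s) \<longleftrightarrow>
    (\<exists>w \<in> {..<r} \<times> {..<s}. \<exists>k \<in> {0, 1, 2}. e = {w, torus_nbr r s k w})"
proof -
  have nbr: "torus_nbr r s 0 (x, y) = (cyc_succ r x, y)"
    "torus_nbr r s 1 (x, y) = (cyc_succ r x, cyc_succ s y)"
    "torus_nbr r s 2 (x, y) = (x, cyc_succ s y)" for x y
    by (simp_all add: torus_nbr_def)
  have "(\<exists>k \<in> {0, 1, 2}. e = {(x, y), torus_nbr r s k (x, y)}) \<longleftrightarrow>
      e = {(x, y), (cyc_succ r x, y)} \<or> e = {(x, y), (x, cyc_succ s y)}
      \<or> e = {(x, y), (cyc_succ r x, cyc_succ s y)}" for x y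
    by (simp only: bex_simps nbr) blast
  then show ?thesis
    unfolding torus_edge_iff by (simp only: Bex_def split_paired_Ex mem_Sigma_iff lessThan_iff) blast
qed

text \<open>Directions 0, 1, 2 are the edges as defined; 3, 4, 5 are the same edges read from the
  other end.\<close>

lemma torus_edge_iff_nbr:
  "{u, v} \<in> edges (torus_triangulation r s) \<longleftrightarrow>
    u \<in> {..<r} \<times> {..<s} \<and> (\<exists>k. v = torus_nbr r s k u)"
proof
  assume "{u, v} \<in> edges (torus_triangulation r s)"
  then obtain w k where w: "w \<in> {..<r} \<times> {..<s}" "{u, v} = {w, torus_nbr r s k w}"
    unfolding torus_edge_iff_forward by blast
  show "u \<in> {..<r} \<times> {..<s} \<and> (\<exists>k. v = torus_nbr r s k u)"
  proof (cases "u = w \<and> v = torus_nbr r s k w")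
    case True
    then show ?thesis using w(1) by blast
  next
    case False
    then have "v = w" "u = torus_nbr r s k w" using w(2) by (auto simp: doubleton_eq_iff)
    then show ?thesis
      using torus_nbr_opposite[OF w(1), of k, symmetric] torus_nbr_verts[OF w(1), of k] by blast
  qed
next
  assume "u \<in> {..<r} \<times> {..<s} \<and> (\<exists>k. v = torus_nbr r s k u)"
  then obtain k where u: "u \<in> {..<r} \<times> {..<s}" and v: "v = torus_nbr r s k u" by blast
  have red: "torus_nbr r s (j mod 6) = torus_nbr r s j" for j
    using torus_nbr_mod[of r s j 0] by (simp only: add_0_right)
  show "{u, v} \<in> edges (torus_triangulation r s)"
  proof (cases "k mod 6 \<in> {0, 1, 2}")
    case True
    have "{u, v} = {u, torus_nbr r s (k mod 6) u}" unfolding v red by (rule refl)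
    then show ?thesis unfolding torus_edge_iff_forward by (intro bexI[OF _ u] bexI[OF _ True])
  next
    case False
    then have k3: "(k + 3) mod 6 \<in> {0, 1, 2}"
      unfolding insert_iff empty_iff by presburger
    have "{u, v} = {v, torus_nbr r s ((k + 3) mod 6) v}"
      unfolding v red torus_nbr_opposite[OF u] by (rule insert_commute)
    moreover have "v \<in> {..<r} \<times> {..<s}" unfolding v by (rule torus_nbr_verts[OF u])
    ultimately show ?thesis unfolding torus_edge_iff_forward by (intro bexI[of _ v] bexI[OF _ k3])
  qed
qed

lemma torus_hexagonal: "hexagonal_triangulation (torus_triangulation r s) (torus_nbr r s)"
proof
  show "torus_nbr r s (k + 6) v = torus_nbr r s k v" for k v
    unfolding torus_nbr_def mod_add_self2 by (rule refl)
qed (simp_all only: torus_verts torus_edge_iff_nbr torus_nbr_opposite torus_nbr_left torus_nbr_verts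
    finite_SigmaI finite_lessThan)

section \<open>Torus colorings given in coordinates\<close>

definition torus_coloring :: "nat \<Rightarrow> nat \<Rightarrow> (nat \<Rightarrow> nat \<Rightarrow> nat) \<Rightarrow> nat \<times> nat \<Rightarrow> nat" where
  "torus_coloring r s F = (\<lambda>(x, y) \<in> {..<r} \<times> {..<s}. F x y)"

text \<open>Only forward neighbors are compared, since every edge is forward from one of its
  ends.\<close>

definition torus_proper :: "nat \<Rightarrow> nat \<Rightarrow> (nat \<Rightarrow> nat \<Rightarrow> nat) \<Rightarrow> bool" where
  "torus_proper r s F \<longleftrightarrow> (\<forall>x<r. \<forall>y<s. F x y \<in> {1..4} \<and> F x y \<noteq> F (cyc_succ r x) y \<and>
    F x y \<noteq> F x (cyc_succ s y) \<and> F x y \<noteq> F (cyc_succ r x) (cyc_succ s y))"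

definition torus_antipodal :: "nat \<Rightarrow> nat \<Rightarrow> (nat \<Rightarrow> nat \<Rightarrow> nat) \<Rightarrow> nat \<Rightarrow> (nat \<times> nat) set" where
  "torus_antipodal r s F c = {(x, y). x < r \<and> y < s \<and> F x y = c \<and>
    F (cyc_succ r x) y = F (cyc_pred r x) y \<and>
    F (cyc_succ r x) (cyc_succ s y) = F (cyc_pred r x) (cyc_pred s y) \<and>
    F x (cyc_succ s y) = F x (cyc_pred s y)}"

lemma torus_coloring_colorings:
  assumes "torus_proper r s F"
  shows "torus_coloring r s F \<in> colorings (torus_triangulation r s) 4"
proof -
  have "torus_coloring r s F u \<noteq> torus_coloring r s F v"
    if uv: "{u, v} \<in> edges (torus_triangulation r s)" for u v
  proof -
    obtain x y where xy: "x < r" "y < s" and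
      "{u, v} = {(x, y), (cyc_succ r x, y)} \<or> {u, v} = {(x, y), (x, cyc_succ s y)}
        \<or> {u, v} = {(x, y), (cyc_succ r x, cyc_succ s y)}"
      using uv unfolding torus_edge_iff by blast
    moreover have "F x y \<noteq> F (cyc_succ r x) y" "F x y \<noteq> F x (cyc_succ s y)"
      "F x y \<noteq> F (cyc_succ r x) (cyc_succ s y)"
      using assms xy unfolding torus_proper_def by blast+
    ultimately show ?thesis
      using cyc_less[OF xy(1)] cyc_less[OF xy(2)]
      by (auto simp: torus_coloring_def doubleton_eq_iff)
  qed
  moreover have "torus_coloring r s F \<in> {..<r} \<times> {..<s} \<rightarrow>\<^sub>E {1..4}"
    using assms unfolding torus_coloring_def torus_proper_def by auto
  ultimately show ?thesis by (simp add: colorings_def torus_verts)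
qed

lemma torus_antipodal_count:
  "hexagonal_triangulation.antipodal_count (torus_triangulation r s) (torus_nbr r s)
    (torus_coloring r s F) c = card (torus_antipodal r s F c)"
proof -
  interpret hexagonal_triangulation "torus_triangulation r s" "torus_nbr r s"
    by (rule torus_hexagonal)
  have "v \<in> {v \<in> verts (torus_triangulation r s). torus_coloring r s F v = c
      \<and> antipodal (torus_coloring r s F) v} \<longleftrightarrow> v \<in> torus_antipodal r s F c" for v
  proof (cases "v \<in> {..<r} \<times> {..<s}")
    case True
    then obtain x y where v: "v = (x, y)" and xy: "x < r" "y < s" by blast
    have f: "torus_coloring r s F (x', y') = F x' y'" if "x' < r" "y' < s" for x' y'
      using that by (simp add: torus_coloring_def)
    have n: "torus_nbr r s 0 (x, y) = (cyc_succ r x, y)"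
      "torus_nbr r s 1 (x, y) = (cyc_succ r x, cyc_succ s y)"
      "torus_nbr r s 2 (x, y) = (x, cyc_succ s y)"
      "torus_nbr r s 3 (x, y) = (cyc_pred r x, y)"
      "torus_nbr r s 4 (x, y) = (cyc_pred r x, cyc_pred s y)"
      "torus_nbr r s 5 (x, y) = (x, cyc_pred s y)"
      by (simp_all add: torus_nbr_def)
    show ?thesis
      unfolding v antipodal_def n torus_antipodal_def mem_Collect_eq prod.case torus_verts
      by (simp only: f xy cyc_less[OF xy(1)] cyc_less[OF xy(2)] mem_Sigma_iff lessThan_iff simp_thms)
  next
    case False
    then show ?thesis by (auto simp: torus_verts torus_antipodal_def)
  qed
  then have "{v \<in> verts (torus_triangulation r s). torus_coloring r s F v = c
      \<and> antipodal (torus_coloring r s F) v} = torus_antipodal r s F c" by (rule set_eqI)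
  then show ?thesis by (simp add: antipodal_count_def)
qed

text \<open>The even coloring is \<open>(x + y) mod 3 + 1\<close>, well defined across the
  wrap-around because 3 divides both sides. It never uses color 4, so that count is 0.\<close>

lemma kappa_torus_ge_2:
  assumes dvd: "3 dvd r" "3 dvd s"
    and F: "torus_proper r s F" and c: "c \<in> {1..4}" and odd: "odd (card (torus_antipodal r s F c))"
  shows "kappa (torus_triangulation r s) 4 \<ge> 2"
proof -
  interpret hexagonal_triangulation "torus_triangulation r s" "torus_nbr r s"
    by (rule torus_hexagonal)
  let ?H = "\<lambda>x y :: nat. (x + y) mod 3 + 1"
  have "torus_proper r s ?H"
    unfolding torus_proper_def
  proof (intro allI impI)
    fix x y assume xy: "x < r" "y < s"
    have x': "cyc_succ r x mod 3 = (x + 1) mod 3" and y': "cyc_succ s y mod 3 = (y + 1) mod 3"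
      using cyc_mod(1)[OF dvd(1) xy(1)] cyc_mod(1)[OF dvd(2) xy(2)] .
    have e: "(cyc_succ r x + y) mod 3 = (x + y + 1) mod 3"
      "(x + cyc_succ s y) mod 3 = (x + y + 1) mod 3"
      "(cyc_succ r x + cyc_succ s y) mod 3 = (x + y + 2) mod 3"
      using mod_add_cong[OF x' refl, of y] mod_add_cong[OF refl y', of x] mod_add_cong[OF x' y']
      by (simp_all add: ac_simps)
    have m: "z mod 3 \<noteq> (z + 1) mod 3" "z mod 3 \<noteq> (z + 2) mod 3" "z mod 3 < 3" for z :: nat
      by presburger+
    show "?H x y \<in> {1..4} \<and> ?H x y \<noteq> ?H (cyc_succ r x) y \<and> ?H x y \<noteq> ?H x (cyc_succ s y)
        \<and> ?H x y \<noteq> ?H (cyc_succ r x) (cyc_succ s y)"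
      unfolding e using m[of "x + y"] by simp
  qed
  moreover have "?H x y \<noteq> 4" for x y
    using mod_less_divisor[of 3 "x + y"] by linarith
  then have "torus_antipodal r s ?H 4 = {}" unfolding torus_antipodal_def by blast
  then have "even (antipodal_count (torus_coloring r s ?H) 4)"
    by (simp add: torus_antipodal_count)
  ultimately show ?thesis
    using kappa_ge_2[OF torus_coloring_colorings torus_coloring_colorings[OF F] _ c, of ?H 4]
      odd torus_antipodal_count[of r s F c]
    by simp
qed

section \<open>Colorings with odd parity\<close>

text \<open>Every vertex is antipodal for this coloring. It gives an odd count when \<open>L = 2\<close>.\<close>

lemma parity_coloring:
  fixes p q :: nat
  defines "F \<equiv> \<lambda>x y :: nat. 1 + x mod 2 + 2 * (y mod 2)"
  shows "torus_proper (2 * p) (2 * q) F" and "card (torus_antipodal (2 * p) (2 * q) F 1) = p * q"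
proof -
  \<comment> \<open>On a cycle of even length both neighbors have the other parity, which makes
    opposite neighbors equal in color.\<close>
  have m: "cyc_succ (2 * k) x mod 2 = 1 - x mod 2" "cyc_pred (2 * k) x mod 2 = 1 - x mod 2"
    if "x < 2 * k" for x k
  proof -
    have f: "a mod 2 = 1 - b mod 2" if "a mod 2 = (b + 1) mod 2 \<or> (a + 1) mod 2 = b mod 2"
      for a b :: nat
      using that by (auto simp: mod2_eq_if split: if_splits)
    show "cyc_succ (2 * k) x mod 2 = 1 - x mod 2"
      by (rule f[OF disjI1[OF cyc_mod(1)[OF dvd_triv_left that]]])
    show "cyc_pred (2 * k) x mod 2 = 1 - x mod 2"
      by (rule f[OF disjI2[OF cyc_mod(2)[OF dvd_triv_left that]]])
  qed
  have b: "x mod 2 = 0 \<or> x mod 2 = 1" for x :: nat by presburger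
  \<comment> \<open>The four colors encode the pairs of parities; a forward step flips one of them
    or both.\<close>
  have colors: "1 + a + 2 * b \<in> {1..4} \<and> 1 + a + 2 * b \<noteq> 1 + (1 - a) + 2 * b
      \<and> 1 + a + 2 * b \<noteq> 1 + a + 2 * (1 - b) \<and> 1 + a + 2 * b \<noteq> 1 + (1 - a) + 2 * (1 - b)"
    if "a = 0 \<or> a = 1" "b = 0 \<or> b = 1" for a b :: nat
    using that by (elim disjE) simp_all
  show "torus_proper (2 * p) (2 * q) F"
    unfolding torus_proper_def
  proof (intro allI impI)
    fix x y assume xy: "x < 2 * p" "y < 2 * q"
    show "F x y \<in> {1..4} \<and> F x y \<noteq> F (cyc_succ (2 * p) x) y \<and> F x y \<noteq> F x (cyc_succ (2 * q) y)
        \<and> F x y \<noteq> F (cyc_succ (2 * p) x) (cyc_succ (2 * q) y)"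
      unfolding F_def m[OF xy(1)] m[OF xy(2)] by (rule colors[OF b b])
  qed
  \<comment> \<open>Color 1 belongs to the vertices with both coordinates even.\<close>
  let ?h = "\<lambda>(i, j). (2 * i :: nat, 2 * j :: nat)"
  have "torus_antipodal (2 * p) (2 * q) F 1 = ?h ` ({..<p} \<times> {..<q})"
  proof (intro set_eqI)
    fix v :: "nat \<times> nat"
    obtain x y where v: "v = (x, y)" by (rule prod.exhaust)
    have "(x, y) \<in> torus_antipodal (2 * p) (2 * q) F 1 \<longleftrightarrow>
        (x < 2 * p \<and> even x) \<and> (y < 2 * q \<and> even y)"
    proof (cases "x < 2 * p \<and> y < 2 * q")
      case True
      then have xy: "x < 2 * p" "y < 2 * q" by simp_all
      show ?thesis
        unfolding torus_antipodal_def F_def mem_Collect_eq prod.case m[OF xy(1)] m[OF xy(2)]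
        using xy by auto
    qed (auto simp: torus_antipodal_def)
    moreover have "x < 2 * k \<and> even x \<longleftrightarrow> (\<exists>i<k. x = 2 * i)" for x k :: nat
      by (auto elim!: evenE)
    ultimately show "v \<in> torus_antipodal (2 * p) (2 * q) F 1 \<longleftrightarrow> v \<in> ?h ` ({..<p} \<times> {..<q})"
      unfolding v by (simp add: image_iff Bex_def) blast
  qed
  moreover have "inj_on ?h ({..<p} \<times> {..<q})"
    by (auto simp: inj_on_def)
  ultimately show "card (torus_antipodal (2 * p) (2 * q) F 1) = p * q"
    by (simp add: card_image)
qed

text \<open>A coloring of \<open>T(9, 9)\<close> (indices below 9), found by computer search. Repeating the
  indices 0, 9, 10 with period 3 extends it to larger tori.\<close>

definition table :: "nat list list" where
  "table =
     [[1,2,3,4,1,4,3,2,4,2,3],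
      [2,3,1,2,3,2,1,4,3,3,4],
      [1,4,2,3,4,1,4,3,2,4,2],
      [4,2,1,4,1,2,3,2,1,3,1],
      [3,1,4,3,2,3,4,1,4,2,4],
      [2,4,3,2,1,4,1,2,3,1,3],
      [1,3,2,1,4,3,2,3,4,3,4],
      [2,4,1,4,3,2,1,4,1,4,1],
      [4,1,2,3,2,1,4,3,2,1,2],
      [2,3,4,1,3,2,1,4,1,3,1],
      [3,1,2,3,2,1,4,3,2,1,2]]"

definition table_index :: "nat \<Rightarrow> nat" where
  "table_index x = (if x < 9 then x else if 3 dvd x then 0 else 8 + x mod 3)"

definition table_coloring :: "nat \<Rightarrow> nat \<Rightarrow> nat" where
  "table_coloring x y = table ! table_index x ! table_index y"

text \<open>Consecutive indices met along a cycle. The last four combine the predecessors 8 and 10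
  of index 0 with its successors 1 and 9.\<close>

definition index_triples :: "(nat \<times> nat \<times> nat) list" where
  "index_triples =
     [(0,1,2), (1,2,3), (2,3,4), (3,4,5), (4,5,6), (5,6,7), (6,7,8), (7,8,0),
      (0,9,10), (9,10,0), (8,0,1), (8,0,9), (10,0,1), (10,0,9)]"

text \<open>The antipodal vertices of color 1, confirmed by \<open>table_check\<close>. Their number
  is odd.\<close>

definition special :: "(nat \<times> nat) list" where
  "special = [(2,5), (4,7), (7,2)]"

text \<open>Properness and antipodality at a vertex depend only on one index triple per coordinate,
  so 14 * 14 cases settle every size of torus.\<close>

lemma table_check:
  "list_all (\<lambda>(i, j, k). list_all (\<lambda>(l, m, n).
      table ! j ! m \<in> {1, 2, 3, 4} \<and> table ! j ! m \<noteq> table ! k ! m \<and>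
      table ! j ! m \<noteq> table ! j ! n \<and> table ! j ! m \<noteq> table ! k ! n \<and>
      (table ! j ! m = 1 \<and> table ! k ! m = table ! i ! m \<and> table ! k ! n = table ! i ! l \<and>
        table ! j ! n = table ! j ! l \<longleftrightarrow> (j, m) \<in> set special))
    index_triples) index_triples"
  by code_simp

lemma table_index_ge:
  assumes "3 \<le> j"
  shows "table_index (3 * j) = 0" "table_index (3 * j + 1) = 9" "table_index (3 * j + 2) = 10"
proof -
  have "(3 * j + 1) mod 3 = 1" "(3 * j + 2) mod 3 = 2"
    using mod_mult_self4[of 3 j 1] mod_mult_self4[of 3 j 2] by simp_all
  then show "table_index (3 * j) = 0" "table_index (3 * j + 1) = 9" "table_index (3 * j + 2) = 10"
    using assms by (simp_all only: table_index_def dvd_eq_mod_eq_0 mod_mult_self1_is_0) simp_all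
qed

text \<open>Index 8 precedes coordinate 9; index 10 precedes later multiples of 3.\<close>

lemma table_index_pred:
  assumes "3 \<le> j"
  shows "table_index (3 * j - 1) \<in> {8, 10}"
proof -
  obtain i where i: "j = i + 1" "2 \<le> i" using assms by (cases j) auto
  have "table_index (3 * i + 2) \<in> {8, 10}"
    using i(2) table_index_ge(3)[of i] by (cases "i = 2") (simp add: table_index_def, simp)
  then show ?thesis using i(1) by simp
qed

text \<open>As 3 divides \<open>r\<close>, the cycle closes only after a full block, where both the
  wrap-around and a further block continue with index 0.\<close>

lemma index_triple:
  assumes r: "3 dvd r" "9 \<le> r" and x: "x < r"
  shows "(table_index (cyc_pred r x), table_index x, table_index (cyc_succ r x))
    \<in> set index_triples"
proof -
  obtain k where k: "r = 3 * k" using r(1) by (rule dvdE)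
  have "x = 0 \<or> 1 \<le> x \<and> x \<le> 8 \<or> 9 \<le> x" by linarith
  then show ?thesis
  proof (elim disjE conjE)
    assume 1: "x = 0"
    have "table_index (r - 1) \<in> {8, 10}" using r(2) k table_index_pred[of k] by simp
    moreover have "cyc_pred r x = r - 1" "cyc_succ r x = 1" "table_index x = 0" "table_index 1 = 1"
      using 1 x r by (simp_all add: cyc_pred_eq cyc_succ_eq table_index_def)
    ultimately show ?thesis by (auto simp: index_triples_def)
  next
    assume "1 \<le> x" "x \<le> 8"
    then have "x \<in> {1, 2, 3, 4, 5, 6, 7, 8}" by auto
    then show ?thesis
      using r x
      by (elim insertE emptyE)
        (simp_all add: cyc_pred_eq cyc_succ_eq table_index_def index_triples_def)
  next
    assume x9: "9 \<le> x"
    define j where "j = x div 3"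
    have j: "3 \<le> j" using x9 unfolding j_def by linarith
    have "x mod 3 < 3" "x = 3 * j + x mod 3" unfolding j_def by simp_all
    then have "x = 3 * j \<or> x = 3 * j + 1 \<or> x = 3 * j + 2" by linarith
    then show ?thesis
    proof (elim disjE)
      assume xj: "x = 3 * j"
      have "x + 1 \<noteq> r" unfolding xj k by presburger
      then have "cyc_pred r x = 3 * j - 1" "cyc_succ r x = 3 * j + 1"
        using x xj j by (simp_all add: cyc_pred_eq cyc_succ_eq)
      then show ?thesis
        using table_index_ge[OF j] table_index_pred[OF j] xj by (auto simp: index_triples_def)
    next
      assume xj: "x = 3 * j + 1"
      have "x + 1 \<noteq> r" unfolding xj k by presburger
      then have "cyc_pred r x = 3 * j" "cyc_succ r x = 3 * j + 2"
        using x xj by (simp_all add: cyc_pred_eq cyc_succ_eq)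
      then show ?thesis
        using table_index_ge[OF j] xj by (simp add: index_triples_def)
    next
      assume xj: "x = 3 * j + 2"
      then have "cyc_pred r x = 3 * j + 1"
        "cyc_succ r x = 0 \<or> cyc_succ r x = 3 * (j + 1)"
        using x by (simp_all add: cyc_pred_eq cyc_succ_eq)
      moreover have "table_index 0 = 0" "table_index (3 * (j + 1)) = 0"
        using table_index_ge(1)[of "j + 1"] j by (simp_all add: table_index_def)
      ultimately show ?thesis
        using table_index_ge[OF j] xj by (auto simp: index_triples_def)
    qed
  qed
qed

text \<open>Indices 1 to 7 come from one coordinate each, so extending the table does not multiply
  the special vertices.\<close>

lemma table_index_special:
  "(table_index x, table_index y) \<in> set special \<longleftrightarrow> (x, y) \<in> set special"
proof -
  have inner: "table_index z = z" if "1 \<le> z" "z \<le> 8" for z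
    using that by (simp add: table_index_def)
  have inv: "z \<le> 8" if "table_index z = i" "1 \<le> i" "i \<le> 7" for z i
    using that by (auto simp: table_index_def dvd_eq_mod_eq_0 split: if_splits)
  have bounds: "1 \<le> i \<and> i \<le> 7 \<and> 1 \<le> j \<and> j \<le> 7" if "(i, j) \<in> set special" for i j
    using that by (auto simp: special_def)
  show ?thesis
  proof
    assume a: "(table_index x, table_index y) \<in> set special"
    have "x \<le> 8" "y \<le> 8" using bounds[OF a] inv by blast+
    then have "table_index x = x" "table_index y = y" by (simp_all add: table_index_def)
    then show "(x, y) \<in> set special" using a by simp
  next
    assume a: "(x, y) \<in> set special"
    have "table_index x = x" "table_index y = y" using bounds[OF a] inner by simp_all
    then show "(table_index x, table_index y) \<in> set special" using a by simp
  qed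
qed

lemma table_coloring_torus:
  assumes r: "3 dvd r" "9 \<le> r" and s: "3 dvd s" "9 \<le> s"
  shows "torus_proper r s table_coloring" and "card (torus_antipodal r s table_coloring 1) = 3"
proof -
  have chk: "table_coloring x y \<in> {1, 2, 3, 4} \<and>
      table_coloring x y \<noteq> table_coloring (cyc_succ r x) y \<and>
      table_coloring x y \<noteq> table_coloring x (cyc_succ s y) \<and>
      table_coloring x y \<noteq> table_coloring (cyc_succ r x) (cyc_succ s y) \<and>
      (table_coloring x y = 1 \<and>
        table_coloring (cyc_succ r x) y = table_coloring (cyc_pred r x) y \<and>
        table_coloring (cyc_succ r x) (cyc_succ s y) = table_coloring (cyc_pred r x) (cyc_pred s y) \<and>
        table_coloring x (cyc_succ s y) = table_coloring x (cyc_pred s y)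
        \<longleftrightarrow> (table_index x, table_index y) \<in> set special)"
    if xy: "x < r" "y < s" for x y
    using table_check[unfolded list_all_iff, THEN bspec, OF index_triple[OF r xy(1)],
        unfolded prod.case, THEN bspec, OF index_triple[OF s xy(2)], unfolded prod.case]
    unfolding table_coloring_def .
  have range: "{1, 2, 3, 4} = {1..4 :: nat}" by auto
  show "torus_proper r s table_coloring"
    unfolding torus_proper_def range[symmetric] using chk by blast
  have "(x, y) \<in> torus_antipodal r s table_coloring 1 \<longleftrightarrow> (x, y) \<in> set special" for x y
  proof -
    have "x < r \<and> y < s" if "(x, y) \<in> set special"
      using that r(2) s(2) by (auto simp: special_def)
    then show ?thesis
      using chk[of x y] unfolding torus_antipodal_def mem_Collect_eq prod.case table_index_special
      by blast
  qed
  then have "torus_antipodal r s table_coloring 1 = set special" by (auto simp only:)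
  then show "card (torus_antipodal r s table_coloring 1) = 3" by (simp add: special_def)
qed

theorem theorem5p1:
  fixes L p q :: nat
  assumes "L \<ge> 2"
    and "p > 0" and "odd p"
    and "q > 0" and "odd q"
  shows "kappa (torus_triangulation (3 * L * p) (3 * L * q)) 4 \<ge> 2"
proof (cases "L = 2")
  \<comment> \<open>Both sides are even, and the count \<open>3 * p * (3 * q)\<close> is odd because
    \<open>p\<close> and \<open>q\<close> are.\<close>
  case True
  then have e: "3 * L * p = 2 * (3 * p)" "3 * L * q = 2 * (3 * q)" by simp_all
  show ?thesis unfolding e
    by (rule kappa_torus_ge_2[OF _ _ parity_coloring(1), of _ _ 1])
      (use assms parity_coloring(2)[of "3 * p" "3 * q"] in simp_all)
next
  \<comment> \<open>Now \<open>L\<close> is at least 3, so both sides reach 9 and the table applies,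
    with count 3.\<close>
  case False
  then have L: "9 \<le> 3 * L" using assms(1) by simp
  have "3 * L * 1 \<le> 3 * L * p" "3 * L * 1 \<le> 3 * L * q"
    using assms by (intro mult_le_mono2; simp)+
  then have "9 \<le> 3 * L * p" "9 \<le> 3 * L * q" using L by linarith+
  moreover have "3 dvd 3 * L * p" "3 dvd 3 * L * q" by simp_all
  ultimately show ?thesis
    using kappa_torus_ge_2[of "3 * L * p" "3 * L * q" table_coloring 1] table_coloring_torus by simp
qed

end
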